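(* Let $T>0$ and let $R$ be a continuous path of real symmetric $n\times n$ matrices on $[0,T]$. Set $R^+(t)=\frac12\left(R(t)+|R(t)|\right)$. If $$\mathrm{Tr}\left(\int_0^T\left(t-\frac{t^2}{T}\right)R^+(t)\,dt\right)<1,$$ then the Dirichlet problem $$\ddot y+Ry=0\ \text{ on }[0,T],\qquad y(0)=y(T)=0,$$ has no nontrivial solution.
   Context: $|R(t)|=(R(t)^2)^{1/2}$ is the absolute value of the symmetric matrix $R(t)$, so $R^+(t)$ is the nonnegative part of $R(t)$. Here $y$ takes values in $\mathbb R^n$. *)

theory Defs
  imports "HOL-Analysis.Analysis"
begin

definition symmetric_matrix :: "real^'n^'n \<Rightarrow> bool" where
  "symmetric_matrix A \<longleftrightarrow> transpose A = A"

definition psd_matrix :: "real^'n^'n \<Rightarrow> bool" where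
  "psd_matrix A \<longleftrightarrow> symmetric_matrix A \<and> (\<forall>x. 0 \<le> x \<bullet> (A *v x))"

(* The nonnegative square root; it exists and is unique whenever A is symmetric and
   positive semidefinite, and the value is unspecified for other A. *)
definition matrix_sqrt :: "real^'n^'n \<Rightarrow> real^'n^'n" where
  "matrix_sqrt A = (THE S. psd_matrix S \<and> S ** S = A)"

definition matrix_abs :: "real^'n^'n \<Rightarrow> real^'n^'n" where
  "matrix_abs A = matrix_sqrt (A ** A)"

definition matrix_pos_part :: "real^'n^'n \<Rightarrow> real^'n^'n" where
  "matrix_pos_part A = (1/2) *\<^sub>R (A + matrix_abs A)"

(* Classical solutions of y'' + R y = 0, y(0) = y(T) = 0. Derivatives are taken within
   [0,T], so they are one-sided at the endpoints, and values of y outside [0,T] play no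
   role. If R is continuous, the equation makes every solution C^2 on [0,T]. *)
definition dirichlet_solution ::
    "real \<Rightarrow> (real \<Rightarrow> real^'n^'n) \<Rightarrow> (real \<Rightarrow> real^'n) \<Rightarrow> bool" where
  "dirichlet_solution T R y \<longleftrightarrow>
     (\<exists>y' y''.
        (\<forall>t\<in>{0..T}. (y has_vector_derivative y' t) (at t within {0..T})) \<and>
        (\<forall>t\<in>{0..T}. (y' has_vector_derivative y'' t) (at t within {0..T})) \<and>
        (\<forall>t\<in>{0..T}. y'' t + R t *v y t = 0)) \<and>
     y 0 = 0 \<and> y T = 0"

end

theory Submission
  imports Defs
begin

text \<open>
  Suppose that \<open>y\<close> is a nontrivial solution and put \<open>E = \<integral>\<^sub>0\<^sup>T |y'|\<^sup>2\<close>. Multiplying the equation by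
  \<open>y\<close> and integrating by parts gives \<open>E = \<integral>\<^sub>0\<^sup>T y \<bullet> R y\<close> (\<open>dirichlet_energy_identity\<close>). The right-hand
  side is bounded above pointwise in three steps:

  \<^item> \<open>y \<bullet> R y \<le> y \<bullet> R\<^sup>+ y\<close>, since \<open>|R| - R\<close> is positive semidefinite (\<open>symmetric_matrix_pos_part\<close>);
  \<^item> \<open>y \<bullet> R\<^sup>+ y \<le> Tr R\<^sup>+ |y|\<^sup>2\<close>, since the trace of a positive semidefinite matrix dominates its
    largest eigenvalue (\<open>psd_quadratic_form_le_trace\<close>);
  \<^item> \<open>|y(t)|\<^sup>2 \<le> (t - t\<^sup>2/T) E\<close>, the Cauchy--Schwarz inequality applied on each side of \<open>t\<close>
    (\<open>dirichlet_pointwise_bound\<close>). The factor \<open>t - t\<^sup>2/T\<close> is the diagonal of the Green function of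
    \<open>-d\<^sup>2/dt\<^sup>2\<close> with Dirichlet conditions, that is, the squared norm of evaluation at \<open>t\<close> in the
    energy norm.

  Integrating, \<open>E \<le> E Tr \<integral> (t - t\<^sup>2/T) R\<^sup>+\<close>, and the trace is less than \<open>1\<close>, so \<open>E \<le> 0\<close>. But the
  last bound, taken at a point where \<open>y\<close> does not vanish, forces \<open>E > 0\<close>.

  Most of the work is in the properties of \<open>|R|\<close>. That the nonnegative square root of \<open>R\<^sup>2\<close> exists
  follows from the spectral theorem (\<open>selfadjoint_orthonormal_eigenbasis\<close>), which also computes it;
  its uniqueness is \<open>psd_square_root_unique\<close>. The integral in the hypothesis is meaningful only if
  \<open>R\<^sup>+\<close> is integrable, and for this \<open>t \<mapsto> |R(t)|\<close> is shown to be continuous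
  (\<open>continuous_on_matrix_abs\<close>): uniqueness makes its graph closed, and its values stay bounded.
\<close>

section \<open>The spectral theorem for self-adjoint operators\<close>

text \<open>
  A nonnegative quadratic form has a minimum at each of its zeros, so its derivative vanishes there.
  Concretely, \<open>s \<mapsto> (x + s v) \<bullet> g (x + s v) = 2 s (v \<bullet> g x) + s\<^sup>2 (v \<bullet> g v)\<close> can be nonnegative for
  all \<open>s\<close> only if its linear coefficient is zero.
\<close>

lemma nonneg_form_kernel:
  fixes g :: "'a::real_inner \<Rightarrow> 'a"
  assumes "linear g" and sym: "\<And>x y. x \<bullet> g y = g x \<bullet> y"
    and W: "subspace W" and nonneg: "\<And>w. w \<in> W \<Longrightarrow> 0 \<le> w \<bullet> g w"
    and x: "x \<in> W" "x \<bullet> g x = 0" and v: "v \<in> W"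
  shows "v \<bullet> g x = 0"
proof -
  define a c where "a = v \<bullet> g x" and "c = v \<bullet> g v"
  have c: "0 \<le> c"
    using nonneg v by (simp add: c_def)
  \<comment> \<open>The minimizer would be \<open>- a / c\<close>; the shift by \<open>1\<close> covers the case \<open>c = 0\<close>.\<close>
  define s where "s = - a / (c + 1)"
  have a: "a = - s * (c + 1)"
    using c by (simp add: s_def)
  have "0 \<le> (x + s *\<^sub>R v) \<bullet> g (x + s *\<^sub>R v)"
    by (intro nonneg subspace_add subspace_scale W x v)
  also have "\<dots> = 2 * s * a + s\<^sup>2 * c"
    using x(2) sym[of x v] sym[of v x]
    by (simp add: linear_add linear_scale \<open>linear g\<close> a_def c_def inner_commute
        power2_eq_square algebra_simps)
  also have "\<dots> = - (s\<^sup>2 * (c + 2))"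
    by (simp add: a power2_eq_square algebra_simps)
  finally have "s = 0"
    using c by (simp add: mult_le_0_iff)
  then have "a = 0" by (simp add: a)
  then show ?thesis by (simp add: a_def)
qed

text \<open>
  The eigenvector is a point where the quadratic form attains its maximum \<open>\<mu>\<close> on the unit sphere of
  \<open>W\<close>: the form of \<open>\<mu> - f\<close> is nonnegative on \<open>W\<close> and vanishes there.
\<close>

lemma invariant_subspace_eigenvector:
  fixes f :: "'a::euclidean_space \<Rightarrow> 'a"
  assumes "linear f" and sym: "\<And>x y. x \<bullet> f y = f x \<bullet> y"
    and W: "subspace W" "W \<noteq> {0}" and inv: "f ` W \<subseteq> W"
  obtains x where "x \<in> W" "norm x = 1" "f x = (x \<bullet> f x) *\<^sub>R x"
proof -
  obtain w0 where w0: "w0 \<in> W" "w0 \<noteq> 0"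
    using W subspace_0 by blast
  have "compact (sphere 0 1 \<inter> W)"
    by (intro compact_Int_closed closed_subspace W) simp
  moreover have "sgn w0 \<in> sphere 0 1 \<inter> W"
    using w0 W by (simp add: norm_sgn sgn_div_norm subspace_scale)
  moreover have "continuous_on (sphere 0 1 \<inter> W) (\<lambda>x. x \<bullet> f x)"
    by (intro continuous_intros linear_continuous_on linear_conv_bounded_linear[THEN iffD1] \<open>linear f\<close>)
  ultimately obtain x where x: "x \<in> sphere 0 1 \<inter> W"
    and max: "\<And>y. y \<in> sphere 0 1 \<inter> W \<Longrightarrow> y \<bullet> f y \<le> x \<bullet> f x"
    using continuous_attains_sup[of "sphere 0 1 \<inter> W" "\<lambda>x. x \<bullet> f x"] by blast
  define \<mu> where "\<mu> = x \<bullet> f x"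
  define g where "g = (\<lambda>w. \<mu> *\<^sub>R w - f w)"
  have xW: "x \<in> W" and nx: "norm x = 1" using x by auto
  have xx: "x \<bullet> x = 1"
    using nx by (simp add: norm_eq_1)
  have lin: "linear g"
    unfolding g_def by (intro linear_compose_sub linear_compose_scale_right linear_ident \<open>linear f\<close>)
  have "0 \<le> w \<bullet> g w" if "w \<in> W" for w
  proof (cases "w = 0")
    case False
    have "sgn w \<bullet> f (sgn w) \<le> \<mu>"
      unfolding \<mu>_def using False that W by (intro max) (simp add: norm_sgn sgn_div_norm subspace_scale)
    then have "w \<bullet> f w / (norm w)\<^sup>2 \<le> \<mu>"
      by (simp add: sgn_div_norm linear_scale \<open>linear f\<close> power2_eq_square divide_inverse mult_ac)
    then show ?thesis
      using False by (simp add: g_def inner_diff_right field_simps flip: power2_norm_eq_inner)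
  qed (simp add: g_def)
  moreover have "x \<bullet> g x = 0"
    by (simp add: g_def inner_diff_right xx \<mu>_def)
  moreover have "g x \<in> W"
    unfolding g_def using xW inv W by (auto intro: subspace_diff subspace_scale)
  moreover have "u \<bullet> g v = g u \<bullet> v" for u v
    by (simp add: g_def inner_diff_right inner_diff_left sym)
  ultimately have "g x \<bullet> g x = 0"
    using nonneg_form_kernel[OF lin _ W(1)] xW by blast
  then have "f x = (x \<bullet> f x) *\<^sub>R x"
    by (simp add: g_def \<mu>_def)
  with xW nx that show thesis by blast
qed

text \<open>
  Take an orthonormal set \<open>B\<close> of eigenvectors of maximal size. Its orthogonal complement is invariant,
  so if it were nonzero it would contain a further unit eigenvector.
\<close>

theorem selfadjoint_orthonormal_eigenbasis:
  fixes f :: "'a::euclidean_space \<Rightarrow> 'a"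
  assumes "linear f" and sym: "\<And>x y. x \<bullet> f y = f x \<bullet> y"
  obtains B where "finite B" "pairwise orthogonal B" "\<And>b. b \<in> B \<Longrightarrow> norm b = 1"
    "span B = UNIV" "\<And>b. b \<in> B \<Longrightarrow> f b = (b \<bullet> f b) *\<^sub>R b"
proof -
  define E where "E = (\<lambda>B. pairwise orthogonal B \<and> (\<forall>b\<in>B. norm b = 1 \<and> f b = (b \<bullet> f b) *\<^sub>R b))"
  have fin: "finite B \<and> card B \<le> DIM('a)" if "E B" for B
  proof -
    have "independent B"
      using that by (intro pairwise_orthogonal_independent) (auto simp: E_def)
    then show ?thesis using independent_bound by blast
  qed
  have "E {}" by (simp add: E_def)
  then obtain B where B: "E B" and max: "\<And>C. E C \<Longrightarrow> card C \<le> card B"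
    using ex_has_greatest_nat[of E "{}" card "Suc DIM('a)"] fin by (auto simp: less_Suc_eq_le)
  define W where "W = {y. \<forall>b\<in>B. orthogonal b y}"
  have W: "subspace W"
    unfolding W_def by (rule subspace_orthogonal_to_vectors)
  have "f y \<in> W" if "y \<in> W" for y
    unfolding W_def mem_Collect_eq
  proof
    fix b assume b: "b \<in> B"
    have "b \<bullet> f y = ((b \<bullet> f b) *\<^sub>R b) \<bullet> y"
      using sym[of b y] B b by (simp add: E_def)
    also have "\<dots> = 0"
      using that b by (simp add: W_def orthogonal_def)
    finally show "orthogonal b (f y)" by (simp add: orthogonal_def)
  qed
  then have inv: "f ` W \<subseteq> W" by blast
  have "W = {0}"
  proof (rule ccontr)
    assume "W \<noteq> {0}"
    then obtain x where x: "x \<in> W" "norm x = 1" "f x = (x \<bullet> f x) *\<^sub>R x"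
      using invariant_subspace_eigenvector[OF \<open>linear f\<close> sym W _ inv] by blast
    have "x \<notin> B"
      using x by (auto simp: W_def orthogonal_def norm_eq_1)
    moreover have "E (insert x B)"
      using B x unfolding E_def W_def
      by (auto simp: pairwise_insert orthogonal_commute)
    ultimately show False
      using max[of "insert x B"] fin[OF B] by simp
  qed
  moreover have "y - (\<Sum>b\<in>B. (y \<bullet> b) *\<^sub>R b) \<in> W" for y
    unfolding W_def mem_Collect_eq
  proof
    fix b assume b: "b \<in> B"
    have "b \<bullet> (\<Sum>c\<in>B. (y \<bullet> c) *\<^sub>R c) = (\<Sum>c\<in>B. if c = b then y \<bullet> b else 0)"
      unfolding inner_sum_right using B b
      by (intro sum.cong) (auto simp: E_def pairwise_def orthogonal_def norm_eq_1)
    also have "\<dots> = y \<bullet> b"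
      using b fin[OF B] by simp
    finally show "orthogonal b (y - (\<Sum>b\<in>B. (y \<bullet> b) *\<^sub>R b))"
      by (simp add: orthogonal_def inner_diff_right inner_commute)
  qed
  ultimately have "y = (\<Sum>b\<in>B. (y \<bullet> b) *\<^sub>R b)" for y by auto
  moreover have "(\<Sum>b\<in>B. (y \<bullet> b) *\<^sub>R b) \<in> span B" for y
    by (intro span_sum span_scale span_base)
  ultimately have "y \<in> span B" for y
    by simp
  then have "span B = UNIV" by auto
  then show thesis
    using that B fin[OF B] unfolding E_def by blast
qed

section \<open>Operators that are diagonal in an orthonormal basis\<close>

text \<open>The operator with eigenvectors \<open>b \<in> B\<close> and eigenvalues \<open>c b\<close>, when \<open>B\<close> is an orthonormal basis.\<close>

definition spectral_sum :: "'a::euclidean_space set \<Rightarrow> ('a \<Rightarrow> real) \<Rightarrow> 'a \<Rightarrow> 'a" where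
  "spectral_sum B c x = (\<Sum>b\<in>B. (c b * (x \<bullet> b)) *\<^sub>R b)"

lemma linear_spectral_sum: "linear (spectral_sum B c)"
  unfolding spectral_sum_def
  by (auto intro!: linearI simp: algebra_simps sum.distrib scaleR_sum_right)

lemma inner_spectral_sum: "x \<bullet> spectral_sum B c y = (\<Sum>b\<in>B. c b * (x \<bullet> b) * (y \<bullet> b))"
  unfolding spectral_sum_def by (simp add: inner_sum_right mult_ac)

lemma spectral_sum_selfadjoint: "x \<bullet> spectral_sum B c y = spectral_sum B c x \<bullet> y"
  by (simp add: inner_commute[of _ y] inner_spectral_sum mult_ac)

locale orthonormal_basis =
  fixes B :: "'a::euclidean_space set"
  assumes fin: "finite B" and orth: "pairwise orthogonal B"
    and unit: "b \<in> B \<Longrightarrow> norm b = 1" and span: "span B = UNIV"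
begin

lemma expand: "(\<Sum>b\<in>B. (x \<bullet> b) *\<^sub>R b) = x"
  by (rule orthonormal_basis_expand) (use fin orth unit span in auto)

lemma parseval: "(\<Sum>b\<in>B. (x \<bullet> b)\<^sup>2) = (norm x)\<^sup>2"
proof -
  have "(norm x)\<^sup>2 = x \<bullet> (\<Sum>b\<in>B. (x \<bullet> b) *\<^sub>R b)"
    unfolding expand by (simp add: power2_norm_eq_inner)
  then show ?thesis by (simp add: inner_sum_right power2_eq_square)
qed

lemma inner_basis_spectral_sum:
  assumes "b \<in> B"
  shows "spectral_sum B c x \<bullet> b = c b * (x \<bullet> b)"
proof -
  have "spectral_sum B c x \<bullet> b = (\<Sum>a\<in>B. if a = b then c b * (x \<bullet> b) else 0)"
    unfolding spectral_sum_def inner_sum_left using assms orth unit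
    by (intro sum.cong) (auto simp: pairwise_def orthogonal_def norm_eq_1)
  then show ?thesis using assms fin by simp
qed

lemma spectral_sum_basis:
  assumes "b \<in> B"
  shows "spectral_sum B c b = c b *\<^sub>R b"
proof -
  have "spectral_sum B c b = (\<Sum>a\<in>B. if a = b then c b *\<^sub>R b else 0)"
    unfolding spectral_sum_def using assms orth unit
    by (intro sum.cong) (auto simp: pairwise_def orthogonal_def norm_eq_1)
  then show ?thesis using assms fin by simp
qed

lemma spectral_sum_compose: "spectral_sum B c (spectral_sum B d x) = spectral_sum B (\<lambda>b. c b * d b) x"
  unfolding spectral_sum_def[of B c] spectral_sum_def[of B "\<lambda>b. c b * d b"]
  by (intro sum.cong) (simp_all add: inner_basis_spectral_sum mult_ac)

end

lemma symmetric_matrix_inner: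
  fixes A :: "real^'n^'n"
  assumes "symmetric_matrix A"
  shows "x \<bullet> (A *v y) = (A *v x) \<bullet> y"
  by (metis assms dot_lmul_matrix symmetric_matrix_def vector_transpose_matrix)

lemma symmetric_matrixI:
  fixes A :: "real^'n^'n"
  assumes "\<And>x y. x \<bullet> (A *v y) = (A *v x) \<bullet> y"
  shows "symmetric_matrix A"
  unfolding symmetric_matrix_def
  by (metis adjoint_matrix adjoint_unique assms matrix_eq)

lemma symmetric_matrix_spectral:
  fixes A :: "real^'n^'n"
  assumes "symmetric_matrix A"
  obtains B c where "orthonormal_basis B" "(*v) A = spectral_sum B c"
proof -
  obtain B where B: "finite B" "pairwise orthogonal B" "\<And>b. b \<in> B \<Longrightarrow> norm b = 1"
    "span B = UNIV" and eig: "\<And>b. b \<in> B \<Longrightarrow> A *v b = (b \<bullet> (A *v b)) *\<^sub>R b"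
    using selfadjoint_orthonormal_eigenbasis[of "(*v) A"] symmetric_matrix_inner[OF assms] by auto
  interpret orthonormal_basis B
    by unfold_locales (use B in auto)
  have "A *v x = spectral_sum B (\<lambda>b. b \<bullet> (A *v b)) x" for x
  proof -
    have "A *v x = A *v (\<Sum>b\<in>B. (x \<bullet> b) *\<^sub>R b)"
      by (simp add: expand)
    also have "\<dots> = (\<Sum>b\<in>B. (x \<bullet> b) *\<^sub>R (A *v b))"
      by (simp add: linear_sum[OF matrix_vector_mul_linear] matrix_vector_mult_scaleR)
    also have "\<dots> = spectral_sum B (\<lambda>b. b \<bullet> (A *v b)) x"
      unfolding spectral_sum_def
      by (intro sum.cong refl) (subst eig, auto simp: mult_ac)
    finally show ?thesis .
  qed
  then show thesis
    using that orthonormal_basis_axioms by blast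
qed

section \<open>The absolute value of a symmetric matrix\<close>

text \<open>
  Let \<open>D = S - S'\<close>. From \<open>S\<^sup>2 - S'\<^sup>2 = S D + D S'\<close>, a unit eigenvector \<open>b\<close> of \<open>D\<close> with eigenvalue \<open>c\<close>
  satisfies \<open>0 = c (b \<bullet> S b + b \<bullet> S' b)\<close>. If \<open>c \<noteq> 0\<close>, then both nonnegative summands are zero, hence
  so is their difference \<open>b \<bullet> D b = c\<close>. So all eigenvalues of \<open>D\<close> vanish.
\<close>

lemma psd_square_root_unique:
  fixes S S' :: "real^'n^'n"
  assumes S: "psd_matrix S" and S': "psd_matrix S'" and eq: "S ** S = S' ** S'"
  shows "S = S'"
proof -
  define D where "D = S - S'"
  have D: "D *v u = S *v u - S' *v u" for u
    by (simp add: D_def matrix_vector_mult_diff_rdistrib)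
  have symS: "u \<bullet> (S *v v) = (S *v u) \<bullet> v" and symS': "u \<bullet> (S' *v v) = (S' *v u) \<bullet> v"
    and posS: "0 \<le> u \<bullet> (S *v u)" and posS': "0 \<le> u \<bullet> (S' *v u)" for u v
    using S S' symmetric_matrix_inner unfolding psd_matrix_def by blast+
  have symD: "u \<bullet> (D *v v) = (D *v u) \<bullet> v" for u v
    by (simp add: D inner_diff_left inner_diff_right symS symS')
  have sq: "S *v (S *v u) = S' *v (S' *v u)" for u
    using eq by (metis matrix_vector_mul_assoc)
  obtain B c where "orthonormal_basis B" and c: "(*v) D = spectral_sum B c"
    by (rule symmetric_matrix_spectral[OF symmetric_matrixI[OF symD]])
  interpret orthonormal_basis B by fact
  have "c b = 0" if b: "b \<in> B" for b
  proof -
    have eig: "D *v b = c b *\<^sub>R b"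
      unfolding c using b by (rule spectral_sum_basis)
    have bb: "b \<bullet> b = 1" using unit[OF b] by (simp add: norm_eq_1)
    have "0 = b \<bullet> (S *v (S *v b)) - b \<bullet> (S' *v (S' *v b))"
      by (simp add: sq)
    also have "\<dots> = b \<bullet> (S *v (D *v b)) + (D *v b) \<bullet> (S' *v b)"
      by (simp add: D matrix_vector_mult_diff_distrib inner_diff_right inner_diff_left symS symS')
    also have "\<dots> = c b * (b \<bullet> (S *v b) + b \<bullet> (S' *v b))"
      by (simp add: eig matrix_vector_mult_scaleR algebra_simps)
    finally consider "c b = 0" | "b \<bullet> (S *v b) = 0" "b \<bullet> (S' *v b) = 0"
      using posS[of b] posS'[of b] by (metis add_nonneg_eq_0_iff mult_eq_0_iff)
    then show ?thesis
    proof cases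
      case 2
      then have "b \<bullet> (D *v b) = 0" by (simp add: D inner_diff_right)
      then show ?thesis by (simp add: eig bb)
    qed
  qed
  then have "D *v x = 0" for x
    by (simp add: c spectral_sum_def)
  then show ?thesis
    by (simp add: D matrix_eq)
qed

text \<open>
  The square root is a definite description, so a witness and uniqueness are both required. The
  witness keeps the eigenvectors of \<open>A\<close> and replaces each eigenvalue by its absolute value.
\<close>

lemma matrix_abs_spectral:
  fixes A :: "real^'n^'n"
  assumes "orthonormal_basis B" and A: "(*v) A = spectral_sum B c"
  shows "psd_matrix (matrix_abs A)" "matrix_abs A ** matrix_abs A = A ** A"
    "matrix_abs A *v x = spectral_sum B (\<lambda>b. \<bar>c b\<bar>) x"
proof -
  interpret orthonormal_basis B by fact
  define S :: "real^'n^'n" where "S = matrix (spectral_sum B (\<lambda>b. \<bar>c b\<bar>))"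
  have S: "S *v x = spectral_sum B (\<lambda>b. \<bar>c b\<bar>) x" for x
    by (simp add: S_def matrix_works linear_spectral_sum)
  have psd: "psd_matrix S"
    unfolding psd_matrix_def
  proof (intro conjI allI symmetric_matrixI)
    show "x \<bullet> (S *v y) = (S *v x) \<bullet> y" for x y
      unfolding S by (rule spectral_sum_selfadjoint)
    show "0 \<le> x \<bullet> (S *v x)" for x
      unfolding S inner_spectral_sum by (intro sum_nonneg) (simp add: mult.assoc)
  qed
  have sq: "S ** S = A ** A"
    unfolding matrix_eq by (simp add: S A spectral_sum_compose flip: matrix_vector_mul_assoc)
  have "matrix_abs A = S"
    unfolding matrix_abs_def matrix_sqrt_def
    by (rule the_equality) (simp_all add: psd sq psd_square_root_unique[OF _ psd])
  with psd sq S show "psd_matrix (matrix_abs A)" "matrix_abs A ** matrix_abs A = A ** A"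
    "matrix_abs A *v x = spectral_sum B (\<lambda>b. \<bar>c b\<bar>) x" by auto
qed

lemma matrix_abs_square_root:
  fixes A :: "real^'n^'n"
  assumes "symmetric_matrix A"
  shows "psd_matrix (matrix_abs A)" "matrix_abs A ** matrix_abs A = A ** A"
proof -
  obtain B c where B: "orthonormal_basis B" and A: "(*v) A = spectral_sum B c"
    by (rule symmetric_matrix_spectral[OF assms])
  show "psd_matrix (matrix_abs A)" "matrix_abs A ** matrix_abs A = A ** A"
    using matrix_abs_spectral(1,2)[OF B A] .
qed

lemma abs_quadratic_form_le_matrix_abs:
  fixes A :: "real^'n^'n"
  assumes "symmetric_matrix A"
  shows "\<bar>x \<bullet> (A *v x)\<bar> \<le> x \<bullet> (matrix_abs A *v x)"
proof -
  obtain B c where B: "orthonormal_basis B" and A: "(*v) A = spectral_sum B c"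
    by (rule symmetric_matrix_spectral[OF assms])
  have "\<bar>x \<bullet> (A *v x)\<bar> \<le> (\<Sum>b\<in>B. \<bar>c b * (x \<bullet> b) * (x \<bullet> b)\<bar>)"
    unfolding A inner_spectral_sum by (rule sum_abs)
  also have "\<dots> = x \<bullet> (matrix_abs A *v x)"
    unfolding matrix_abs_spectral(3)[OF B A] inner_spectral_sum
    by (intro sum.cong) (simp_all add: abs_mult mult.assoc)
  finally show ?thesis .
qed

lemma symmetric_matrix_pos_part:
  fixes A :: "real^'n^'n"
  assumes "symmetric_matrix A"
  shows "psd_matrix (matrix_pos_part A)" "x \<bullet> (A *v x) \<le> x \<bullet> (matrix_pos_part A *v x)"
proof -
  have P: "matrix_pos_part A *v y = (1/2) *\<^sub>R (A *v y + matrix_abs A *v y)" for y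
    by (simp add: matrix_pos_part_def matrix_vector_mult_add_rdistrib flip: scaleR_matrix_vector_assoc)
  have abs: "symmetric_matrix (matrix_abs A)"
    using matrix_abs_square_root(1)[OF assms] by (simp add: psd_matrix_def)
  have "symmetric_matrix (matrix_pos_part A)"
    by (intro symmetric_matrixI)
      (simp add: P inner_add_right inner_add_left symmetric_matrix_inner[OF assms]
        symmetric_matrix_inner[OF abs])
  moreover have "0 \<le> y \<bullet> (matrix_pos_part A *v y)" for y
    using abs_quadratic_form_le_matrix_abs[OF assms, of y] by (simp add: P inner_add_right)
  ultimately show "psd_matrix (matrix_pos_part A)"
    by (simp add: psd_matrix_def)
  show "x \<bullet> (A *v x) \<le> x \<bullet> (matrix_pos_part A *v x)"
    using abs_quadratic_form_le_matrix_abs[OF assms, of x] by (simp add: P inner_add_right)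
qed

section \<open>The trace of a positive semidefinite matrix\<close>

lemma trace_scaleR:
  fixes A :: "real^'n^'n"
  shows "trace (r *\<^sub>R A) = r * trace A"
  by (simp add: trace_def sum_distrib_left)

lemma trace_eq_sum_axis:
  fixes A :: "real^'n^'n"
  shows "trace A = (\<Sum>i\<in>UNIV. axis i 1 \<bullet> (A *v axis i 1))"
  by (simp add: trace_def matrix_vector_mult_basis column_def inner_axis')

text \<open>
  In an orthonormal eigenbasis, \<open>x \<bullet> P x\<close> is the sum of the eigenvalues weighted by the squared
  coordinates of \<open>x\<close>, each at most \<open>|x|\<^sup>2\<close>, and the trace is the sum of the eigenvalues.
\<close>

lemma psd_quadratic_form_le_trace:
  fixes P :: "real^'n^'n"
  assumes "psd_matrix P"
  shows "x \<bullet> (P *v x) \<le> trace P * (norm x)\<^sup>2"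
proof -
  obtain B c where "orthonormal_basis B" and P: "(*v) P = spectral_sum B c"
    by (rule symmetric_matrix_spectral[OF conjunct1[OF assms[unfolded psd_matrix_def]]])
  interpret orthonormal_basis B by fact
  have c0: "0 \<le> c b" if "b \<in> B" for b
  proof -
    have "c b = b \<bullet> (P *v b)"
      using that unit[OF that] by (simp add: P spectral_sum_basis norm_eq_1)
    then show ?thesis using assms by (simp add: psd_matrix_def)
  qed
  have "trace P = (\<Sum>i\<in>UNIV. \<Sum>b\<in>B. c b * (b $ i)\<^sup>2)"
    unfolding trace_eq_sum_axis P inner_spectral_sum
    by (intro sum.cong) (simp_all add: inner_axis' power2_eq_square mult.assoc)
  also have "\<dots> = (\<Sum>b\<in>B. c b * (\<Sum>i\<in>UNIV. (b $ i)\<^sup>2))"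
    by (subst sum.swap) (simp add: sum_distrib_left)
  also have "\<dots> = (\<Sum>b\<in>B. c b)"
    using unit by (intro sum.cong) (auto simp: norm_eq_1 inner_vec_def power2_eq_square)
  finally have tr: "trace P = (\<Sum>b\<in>B. c b)" .
  have "x \<bullet> (P *v x) = (\<Sum>b\<in>B. c b * (x \<bullet> b)\<^sup>2)"
    unfolding P inner_spectral_sum by (simp add: power2_eq_square mult.assoc)
  also have "\<dots> \<le> (\<Sum>b\<in>B. c b * (norm x)\<^sup>2)"
  proof (intro sum_mono mult_left_mono c0)
    fix b assume "b \<in> B"
    then show "(x \<bullet> b)\<^sup>2 \<le> (norm x)\<^sup>2"
      using parseval[of x] member_le_sum[of b B "\<lambda>b. (x \<bullet> b)\<^sup>2"] fin by simp
  qed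
  finally show ?thesis by (simp add: tr sum_distrib_right)
qed

section \<open>Continuity of the absolute value\<close>

text \<open>
  The norm on matrices is the Frobenius norm, so that a symmetric matrix and its absolute value,
  having the same square, have the same norm.
\<close>

lemma norm_symmetric_matrix:
  fixes A :: "real^'n^'n"
  assumes "symmetric_matrix A"
  shows "(norm A)\<^sup>2 = trace (A ** A)"
proof -
  have "A $ i $ j = A $ j $ i" for i j
  proof -
    have "transpose A $ i $ j = A $ j $ i"
      by (simp add: transpose_def)
    then show ?thesis using assms by (simp add: symmetric_matrix_def)
  qed
  then show ?thesis
    by (simp add: power2_norm_eq_inner inner_vec_def trace_def matrix_matrix_mult_def)
qed

lemma norm_matrix_abs:
  fixes A :: "real^'n^'n"
  assumes "symmetric_matrix A"
  shows "norm (matrix_abs A) = norm A"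
proof -
  have "(norm (matrix_abs A))\<^sup>2 = (norm A)\<^sup>2"
    using matrix_abs_square_root[OF assms] assms
    by (simp add: norm_symmetric_matrix psd_matrix_def)
  then show ?thesis by simp
qed

lemma continuous_on_matrix_mult:
  fixes F :: "'a::topological_space \<Rightarrow> real^'n^'m" and G :: "'a \<Rightarrow> real^'p^'n"
  assumes "continuous_on S F" "continuous_on S G"
  shows "continuous_on S (\<lambda>x. F x ** G x)"
  unfolding matrix_matrix_mult_def by (intro continuous_intros assms)

lemma continuous_on_matrix_vector_mult:
  fixes F :: "'a::topological_space \<Rightarrow> real^'n^'m"
  assumes "continuous_on S F" "continuous_on S y"
  shows "continuous_on S (\<lambda>x. F x *v y x)"
  unfolding matrix_vector_mult_def by (intro continuous_intros assms)

lemma closed_psd: "closed {A :: real^'n^'n. psd_matrix A}"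
proof -
  have "{A :: real^'n^'n. psd_matrix A} = {A. transpose A = A} \<inter> (\<Inter>x. {A. 0 \<le> x \<bullet> (A *v x)})"
    by (auto simp: psd_matrix_def symmetric_matrix_def)
  moreover have "closed {A :: real^'n^'n. transpose A = A}"
    unfolding transpose_def by (intro closed_Collect_eq continuous_intros)
  moreover have "closed {A :: real^'n^'n. 0 \<le> x \<bullet> (A *v x)}" for x
    by (intro closed_Collect_le continuous_intros continuous_on_matrix_vector_mult)
  ultimately show ?thesis by (auto intro!: closed_Int closed_INT)
qed

text \<open>
  By uniqueness of the square root, the graph of \<open>t \<mapsto> |R t|\<close> consists of the pairs \<open>(t, S)\<close> with \<open>S\<close>
  positive semidefinite and \<open>S\<^sup>2 = (R t)\<^sup>2\<close>, which are closed conditions. A bounded function with closed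
  graph is continuous.
\<close>

lemma continuous_on_matrix_abs:
  fixes R :: "'a::euclidean_space \<Rightarrow> real^'n^'n"
  assumes "compact K" and R: "continuous_on K R"
    and sym: "\<And>t. t \<in> K \<Longrightarrow> symmetric_matrix (R t)"
  shows "continuous_on K (\<lambda>t. matrix_abs (R t))"
proof -
  obtain M where M: "\<And>t. t \<in> K \<Longrightarrow> norm (R t) \<le> M"
    using compact_imp_bounded[OF compact_continuous_image[OF R \<open>compact K\<close>]]
    by (auto simp: bounded_iff)
  define Z :: "('a \<times> (real^'n^'n)) set" where "Z = K \<times> {S. psd_matrix S}"
  have eq: "(\<lambda>t. (t, matrix_abs (R t))) ` K
      = {z \<in> Z. snd z ** snd z = R (fst z) ** R (fst z)}"
  proof (intro set_eqI iffI)
    fix z assume "z \<in> (\<lambda>t. (t, matrix_abs (R t))) ` K"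
    then show "z \<in> {z \<in> Z. snd z ** snd z = R (fst z) ** R (fst z)}"
      using matrix_abs_square_root[OF sym] by (auto simp: Z_def)
  next
    fix z assume z: "z \<in> {z \<in> Z. snd z ** snd z = R (fst z) ** R (fst z)}"
    then have K: "fst z \<in> K" and "psd_matrix (snd z)"
      and "snd z ** snd z = R (fst z) ** R (fst z)"
      by (auto simp: Z_def)
    then have "matrix_abs (R (fst z)) = snd z"
      by (metis matrix_abs_square_root psd_square_root_unique sym)
    then show "z \<in> (\<lambda>t. (t, matrix_abs (R t))) ` K"
      using K by (intro image_eqI[of _ _ "fst z"]) simp_all
  qed
  have "closed Z"
    unfolding Z_def by (intro closed_Times compact_imp_closed \<open>compact K\<close> closed_psd)
  moreover have RZ: "continuous_on Z (\<lambda>z. R (fst z))"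
    by (rule continuous_on_compose2[OF R]) (auto simp: Z_def intro: continuous_intros)
  ultimately have "closed {z \<in> Z. snd z ** snd z - R (fst z) ** R (fst z) = 0}"
    by (intro continuous_closed_preimage_constant continuous_intros continuous_on_matrix_mult) auto
  then have clo: "closed ((\<lambda>t. (t, matrix_abs (R t))) ` K)"
    unfolding eq by simp
  show ?thesis
    by (rule continuous_from_closed_graph[of "cball 0 M", OF _ _ clo])
      (use M sym in \<open>auto simp: norm_matrix_abs\<close>)
qed

section \<open>Energy estimates on an interval\<close>

text \<open>
  This is the Cauchy--Schwarz inequality for \<open>\<integral>\<^sub>a\<^sup>b y'\<close>, in the form that the variance of \<open>y'\<close> is
  nonnegative: with \<open>m\<close> the mean of \<open>y'\<close>, expand \<open>0 \<le> \<integral>\<^sub>a\<^sup>b |y' - m|\<^sup>2\<close>.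
\<close>

lemma increment_sq_le_energy:
  fixes y y' :: "real \<Rightarrow> 'a::euclidean_space"
  assumes "a < b" and y: "\<And>t. t \<in> {a..b} \<Longrightarrow> (y has_vector_derivative y' t) (at t within {a..b})"
    and cont: "continuous_on {a..b} y'"
  shows "(norm (y b - y a))\<^sup>2 \<le> (b - a) * integral {a..b} (\<lambda>t. y' t \<bullet> y' t)"
proof -
  define m where "m = (1 / (b - a)) *\<^sub>R (y b - y a)"
  have I: "(y' has_integral (y b - y a)) {a..b}"
    using assms(1) y by (intro fundamental_theorem_of_calculus) auto
  have E: "((\<lambda>t. y' t \<bullet> y' t) has_integral integral {a..b} (\<lambda>t. y' t \<bullet> y' t)) {a..b}"
    by (intro integrable_integral integrable_continuous_real continuous_intros cont)
  have c: "((\<lambda>t. m \<bullet> m) has_integral (b - a) * (m \<bullet> m)) {a..b}"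
    using has_integral_const_real[of "m \<bullet> m" a b] assms(1) by simp
  have "((\<lambda>t. y' t \<bullet> y' t - 2 * (y' t \<bullet> m) + m \<bullet> m) has_integral
      integral {a..b} (\<lambda>t. y' t \<bullet> y' t) - 2 * ((y b - y a) \<bullet> m) + (b - a) * (m \<bullet> m)) {a..b}"
    using has_integral_linear[OF I bounded_linear_inner_left, of m]
    by (intro has_integral_add has_integral_diff has_integral_mult_right E c) (simp add: o_def)
  moreover have "0 \<le> y' t \<bullet> y' t - 2 * (y' t \<bullet> m) + m \<bullet> m" for t
    using inner_ge_zero[of "y' t - m"]
    by (simp add: inner_diff_left inner_diff_right inner_commute)
  ultimately have "0 \<le> integral {a..b} (\<lambda>t. y' t \<bullet> y' t) - 2 * ((y b - y a) \<bullet> m) + (b - a) * (m \<bullet> m)"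
    by (rule has_integral_nonneg)
  also have "\<dots> = integral {a..b} (\<lambda>t. y' t \<bullet> y' t) - (norm (y b - y a))\<^sup>2 / (b - a)"
  proof -
    have "(y b - y a) \<bullet> m = (norm (y b - y a))\<^sup>2 / (b - a)"
      by (simp add: m_def power2_norm_eq_inner)
    moreover have "(b - a) * (m \<bullet> m) = (norm (y b - y a))\<^sup>2 / (b - a)"
      using assms(1) by (simp add: m_def power2_norm_eq_inner)
    ultimately show ?thesis by simp
  qed
  finally show ?thesis
    using assms(1) by (simp add: field_simps)
qed

text \<open>
  Let \<open>0 < t < T\<close>. As \<open>y\<close> vanishes at both ends, the energies on \<open>[0, t]\<close> and \<open>[t, T]\<close> are at
  least \<open>|y t|\<^sup>2 / t\<close> and \<open>|y t|\<^sup>2 / (T - t)\<close>, and \<open>1/t + 1/(T - t)\<close> is the reciprocal of \<open>t - t\<^sup>2/T\<close>.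
\<close>

lemma dirichlet_pointwise_bound:
  fixes y y' :: "real \<Rightarrow> 'a::euclidean_space"
  assumes T: "T > 0" and y: "\<And>t. t \<in> {0..T} \<Longrightarrow> (y has_vector_derivative y' t) (at t within {0..T})"
    and cont: "continuous_on {0..T} y'" and bc: "y 0 = 0" "y T = 0" and t: "t \<in> {0..T}"
  shows "(norm (y t))\<^sup>2 \<le> (t - t\<^sup>2 / T) * integral {0..T} (\<lambda>t. y' t \<bullet> y' t)"
proof (cases "t = 0 \<or> t = T")
  case True
  then show ?thesis using bc T by (auto simp: power2_eq_square)
next
  case False
  then have t0: "0 < t" "t < T" using t by auto
  define N where "N = (norm (y t))\<^sup>2"
  have sub: "(norm (y b - y a))\<^sup>2 \<le> (b - a) * integral {a..b} (\<lambda>t. y' t \<bullet> y' t)"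
    if "0 \<le> a" "a < b" "b \<le> T" for a b
    using that by (intro increment_sq_le_energy continuous_on_subset[OF cont])
      (auto intro: has_vector_derivative_within_subset[OF y])
  have "N \<le> t * integral {0..t} (\<lambda>t. y' t \<bullet> y' t)"
    using sub[of 0 t] t0 bc by (simp add: N_def)
  moreover have "N \<le> (T - t) * integral {t..T} (\<lambda>t. y' t \<bullet> y' t)"
    using sub[of t T] t0 bc by (simp add: N_def)
  moreover have "integral {0..t} (\<lambda>t. y' t \<bullet> y' t) + integral {t..T} (\<lambda>t. y' t \<bullet> y' t)
      = integral {0..T} (\<lambda>t. y' t \<bullet> y' t)"
    using t0 by (intro Henstock_Kurzweil_Integration.integral_combine integrable_continuous_real continuous_intros cont) auto
  ultimately have "N / t + N / (T - t) \<le> integral {0..T} (\<lambda>t. y' t \<bullet> y' t)"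
    using t0 by (smt (verit) divide_le_eq mult.commute)
  moreover have "N = (t - t\<^sup>2 / T) * (N / t + N / (T - t))"
    using t0 T by (simp add: field_simps power2_eq_square)
  moreover have "0 \<le> t - t\<^sup>2 / T"
    using t0 T by (simp add: field_simps power2_eq_square)
  ultimately show ?thesis
    unfolding N_def[symmetric] by (metis mult_left_mono)
qed

text \<open>
  The boundary terms vanish in the integral of \<open>(y \<bullet> y')' = |y'|\<^sup>2 - y \<bullet> R y\<close>.
\<close>

lemma dirichlet_energy_identity:
  fixes R :: "real \<Rightarrow> real^'n^'n" and y y' y'' :: "real \<Rightarrow> real^'n"
  assumes T: "T > 0"
    and y: "\<And>t. t \<in> {0..T} \<Longrightarrow> (y has_vector_derivative y' t) (at t within {0..T})"
    and y': "\<And>t. t \<in> {0..T} \<Longrightarrow> (y' has_vector_derivative y'' t) (at t within {0..T})"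
    and eq: "\<And>t. t \<in> {0..T} \<Longrightarrow> y'' t + R t *v y t = 0"
    and bc: "y 0 = 0" "y T = 0"
  shows "((\<lambda>t. y t \<bullet> (R t *v y t)) has_integral integral {0..T} (\<lambda>t. y' t \<bullet> y' t)) {0..T}"
proof -
  have "continuous_on {0..T} y'"
    using y' by (meson continuous_on_vector_derivative)
  then have E: "((\<lambda>t. y' t \<bullet> y' t) has_integral integral {0..T} (\<lambda>t. y' t \<bullet> y' t)) {0..T}"
    by (intro integrable_integral integrable_continuous_real continuous_intros)
  have "((\<lambda>t. y' t \<bullet> y' t - y t \<bullet> (R t *v y t)) has_integral y T \<bullet> y' T - y 0 \<bullet> y' 0) {0..T}"
  proof (rule fundamental_theorem_of_calculus)
    fix t assume t: "t \<in> {0..T}"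
    have "y'' t = - (R t *v y t)"
      using eq[OF t] by (simp add: eq_neg_iff_add_eq_0)
    then show "((\<lambda>t. y t \<bullet> y' t) has_vector_derivative y' t \<bullet> y' t - y t \<bullet> (R t *v y t)) (at t within {0..T})"
      using bounded_bilinear.has_vector_derivative[OF bounded_bilinear_inner y[OF t] y'[OF t]]
      by simp
  qed (use T in simp)
  from has_integral_diff[OF E this] show ?thesis
    using bc by simp
qed

section \<open>Nonexistence of nontrivial Dirichlet solutions\<close>

theorem corollary1p4:
  fixes T :: real and R :: "real \<Rightarrow> real^'n^'n"
  assumes "T > 0"
    and "continuous_on {0..T} R"
    and "\<And>t. t \<in> {0..T} \<Longrightarrow> symmetric_matrix (R t)"
    and "trace (integral {0..T} (\<lambda>t. (t - t\<^sup>2 / T) *\<^sub>R matrix_pos_part (R t))) < 1"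
  shows "\<not> (\<exists>y :: real \<Rightarrow> real^'n. dirichlet_solution T R y \<and> (\<exists>t\<in>{0..T}. y t \<noteq> 0))"
proof
  assume "\<exists>y :: real \<Rightarrow> real^'n. dirichlet_solution T R y \<and> (\<exists>t\<in>{0..T}. y t \<noteq> 0)"
  then obtain y y' y'' and s where
    y: "\<And>t. t \<in> {0..T} \<Longrightarrow> (y has_vector_derivative y' t) (at t within {0..T})"
    and y': "\<And>t. t \<in> {0..T} \<Longrightarrow> (y' has_vector_derivative y'' t) (at t within {0..T})"
    and eq: "\<And>t. t \<in> {0..T} \<Longrightarrow> y'' t + R t *v y t = 0"
    and bc: "y 0 = 0" "y T = 0" and s: "s \<in> {0..T}" "y s \<noteq> 0"
    unfolding dirichlet_solution_def by metis
  define P where "P t = matrix_pos_part (R t)" for t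
  define E where "E = integral {0..T} (\<lambda>t. y' t \<bullet> y' t)"
  have cy': "continuous_on {0..T} y'"
    using y' by (meson continuous_on_vector_derivative)
  have bound: "(norm (y t))\<^sup>2 \<le> (t - t\<^sup>2 / T) * E" if "t \<in> {0..T}" for t
    unfolding E_def by (intro dirichlet_pointwise_bound \<open>T > 0\<close> y cy' bc that)
  have "E > 0"
  proof -
    have "0 < (norm (y s))\<^sup>2" using s by simp
    then have "0 < (s - s\<^sup>2 / T) * E" using bound[OF s(1)] by linarith
    moreover have "0 \<le> s - s\<^sup>2 / T"
      using s(1) \<open>T > 0\<close> by (simp add: field_simps power2_eq_square mult_right_mono)
    ultimately show ?thesis by (simp add: zero_less_mult_iff)
  qed
  have "continuous_on {0..T} (\<lambda>t. (t - t\<^sup>2 / T) *\<^sub>R P t)"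
    unfolding P_def matrix_pos_part_def using assms
    by (intro continuous_intros continuous_on_matrix_abs) auto
  then have "((\<lambda>t. (t - t\<^sup>2 / T) *\<^sub>R P t) has_integral
      integral {0..T} (\<lambda>t. (t - t\<^sup>2 / T) *\<^sub>R P t)) {0..T}"
    by (intro integrable_integral integrable_continuous_real)
  moreover have "bounded_linear (trace :: real^'n^'n \<Rightarrow> real)"
    unfolding linear_conv_bounded_linear[symmetric]
    by (intro linearI) (simp_all add: trace_add trace_scaleR)
  ultimately have "((\<lambda>t. trace ((t - t\<^sup>2 / T) *\<^sub>R P t)) has_integral
      trace (integral {0..T} (\<lambda>t. (t - t\<^sup>2 / T) *\<^sub>R P t))) {0..T}"
    using has_integral_linear unfolding o_def by blast
  then have J: "((\<lambda>t. trace ((t - t\<^sup>2 / T) *\<^sub>R P t) * E) has_integral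
      trace (integral {0..T} (\<lambda>t. (t - t\<^sup>2 / T) *\<^sub>R P t)) * E) {0..T}"
    by (rule has_integral_mult_left)
  have "E \<le> trace (integral {0..T} (\<lambda>t. (t - t\<^sup>2 / T) *\<^sub>R P t)) * E"
  proof (rule has_integral_le[OF _ J])
    show "((\<lambda>t. y t \<bullet> (R t *v y t)) has_integral E) {0..T}"
      unfolding E_def by (rule dirichlet_energy_identity[OF \<open>T > 0\<close> y y' eq bc])
    fix t assume t: "t \<in> {0..T}"
    have psd: "psd_matrix (P t)"
      unfolding P_def by (rule symmetric_matrix_pos_part assms t)+
    have tr: "0 \<le> trace (P t)"
      using psd unfolding trace_eq_sum_axis psd_matrix_def by (simp add: sum_nonneg)
    have "y t \<bullet> (R t *v y t) \<le> y t \<bullet> (P t *v y t)"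
      unfolding P_def by (rule symmetric_matrix_pos_part assms t)+
    also have "\<dots> \<le> trace (P t) * (norm (y t))\<^sup>2"
      by (rule psd_quadratic_form_le_trace[OF psd])
    also have "\<dots> \<le> trace (P t) * ((t - t\<^sup>2 / T) * E)"
      by (rule mult_left_mono[OF bound[OF t] tr])
    also have "\<dots> = trace ((t - t\<^sup>2 / T) *\<^sub>R P t) * E"
      by (simp add: trace_scaleR mult_ac)
    finally show "y t \<bullet> (R t *v y t) \<le> trace ((t - t\<^sup>2 / T) *\<^sub>R P t) * E" .
  qed
  with \<open>E > 0\<close> assms(4) show False
    unfolding P_def by (simp add: mult_less_cancel_right2 flip: not_less)
qed

end
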